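(* Let $n\ge1$. An element $\alpha\in\mathcal{ODCT}_n$ is regular if and only if $\alpha$ is an idempotent.
   Context: $[n]=\{1,2,\ldots,n\}$ with its usual order. Maps are written on the right of their arguments. $\mathcal{ODCT}_n$ is the semigroup (under composition, $x(\alpha\beta)=(x\alpha)\beta$) of all maps $\alpha:[n]\to[n]$ that are contractions ($|x\alpha-y\alpha|\le|x-y|$ for all $x,y\in[n]$), order-preserving ($x\le y\Rightarrow x\alpha\le y\alpha$) and order-decreasing ($x\alpha\le x$ for all $x\in[n]$). An element $\alpha$ of a semigroup $S$ is regular if there is $\gamma\in S$ with $\alpha=\alpha\gamma\alpha$ (here $S=\mathcal{ODCT}_n$), and idempotent if $\alpha^2=\alpha$. *)

theory Defs
  imports Main "HOL-Library.FuncSet"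
begin

(* An element a of a semigroup with carrier S and multiplication m. *)

definition regular_elem :: "'a set \<Rightarrow> ('a \<Rightarrow> 'a \<Rightarrow> 'a) \<Rightarrow> 'a \<Rightarrow> bool" where
  "regular_elem S m a \<longleftrightarrow> (\<exists>c\<in>S. a = m (m a c) a)"

definition idempotent_elem :: "('a \<Rightarrow> 'a \<Rightarrow> 'a) \<Rightarrow> 'a \<Rightarrow> bool" where
  "idempotent_elem m a \<longleftrightarrow> m a a = a"

(* Self-maps of [n] are extensional functions (undefined outside {1..n}), so that
   equality in HOL is equality of maps on [n].  Distances are taken in int because
   subtraction on nat truncates. *)

definition contraction_on :: "nat set \<Rightarrow> (nat \<Rightarrow> nat) \<Rightarrow> bool" where
  "contraction_on A f \<longleftrightarrow>
     (\<forall>x\<in>A. \<forall>y\<in>A. \<bar>int (f x) - int (f y)\<bar> \<le> \<bar>int x - int y\<bar>)"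

definition order_decreasing_on :: "nat set \<Rightarrow> (nat \<Rightarrow> nat) \<Rightarrow> bool" where
  "order_decreasing_on A f \<longleftrightarrow> (\<forall>x\<in>A. f x \<le> x)"

definition ODCT :: "nat \<Rightarrow> (nat \<Rightarrow> nat) set" where
  "ODCT n = {f \<in> {1..n} \<rightarrow>\<^sub>E {1..n}.
     contraction_on {1..n} f \<and> mono_on {1..n} f \<and> order_decreasing_on {1..n} f}"

(* Maps act on the right: x (f g) = (x f) g, so f is applied first. *)

definition rcomp :: "nat \<Rightarrow> (nat \<Rightarrow> nat) \<Rightarrow> (nat \<Rightarrow> nat) \<Rightarrow> (nat \<Rightarrow> nat)" where
  "rcomp n f g = compose {1..n} g f"

lemma rcomp_closed:
  assumes "f \<in> ODCT n" "g \<in> ODCT n"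
  shows "rcomp n f g \<in> ODCT n"
proof -
  have f: "f x \<in> {1..n}" if "x \<in> {1..n}" for x
    using assms(1) that unfolding ODCT_def by (blast dest: PiE_mem)
  have g: "g x \<in> {1..n}" if "x \<in> {1..n}" for x
    using assms(2) that unfolding ODCT_def by (blast dest: PiE_mem)
  have eq: "rcomp n f g x = g (f x)" if "x \<in> {1..n}" for x
    using that by (simp add: rcomp_def compose_def)
  have "rcomp n f g \<in> {1..n} \<rightarrow>\<^sub>E {1..n}"
    using f g by (auto simp: rcomp_def compose_def restrict_def PiE_iff extensional_def)
  moreover have "contraction_on {1..n} (rcomp n f g)"
    unfolding contraction_on_def
  proof (intro ballI)
    fix x y assume xy: "x \<in> {1..n}" "y \<in> {1..n}"
    have "\<bar>int (g (f x)) - int (g (f y))\<bar> \<le> \<bar>int (f x) - int (f y)\<bar>"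
      using assms(2) f[OF xy(1)] f[OF xy(2)] unfolding ODCT_def contraction_on_def by blast
    also have "\<dots> \<le> \<bar>int x - int y\<bar>"
      using assms(1) xy unfolding ODCT_def contraction_on_def by blast
    finally show "\<bar>int (rcomp n f g x) - int (rcomp n f g y)\<bar> \<le> \<bar>int x - int y\<bar>"
      using eq xy by simp
  qed
  moreover have "mono_on {1..n} (rcomp n f g)"
  proof (rule mono_onI)
    fix x y assume xy: "x \<in> {1..n}" "y \<in> {1..n}" "x \<le> y"
    have "f x \<le> f y"
      using assms(1) xy unfolding ODCT_def by (blast dest: mono_onD)
    then have "g (f x) \<le> g (f y)"
      using assms(2) f[OF xy(1)] f[OF xy(2)] unfolding ODCT_def by (blast dest: mono_onD)
    then show "rcomp n f g x \<le> rcomp n f g y"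
      using eq xy by simp
  qed
  moreover have "order_decreasing_on {1..n} (rcomp n f g)"
    unfolding order_decreasing_on_def
  proof
    fix x assume x: "x \<in> {1..n}"
    have "g (f x) \<le> f x"
      using assms(2) f[OF x] unfolding ODCT_def order_decreasing_on_def by blast
    also have "\<dots> \<le> x"
      using assms(1) x unfolding ODCT_def order_decreasing_on_def by blast
    finally show "rcomp n f g x \<le> x" using eq x by simp
  qed
  ultimately show ?thesis by (simp add: ODCT_def)
qed

lemma rcomp_assoc:
  assumes "f \<in> ODCT n"
  shows "rcomp n (rcomp n f g) h = rcomp n f (rcomp n g h)"
proof
  fix x
  have "f x \<in> {1..n}" if "x \<in> {1..n}"
    using assms that unfolding ODCT_def by (blast dest: PiE_mem)
  then show "rcomp n (rcomp n f g) h x = rcomp n f (rcomp n g h) x"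
    by (auto simp: rcomp_def compose_def restrict_def)
qed

end

theory Submission
  imports Defs
begin

text \<open>If \<open>\<alpha>\<close> is idempotent, then \<open>\<alpha> = \<alpha>\<alpha>\<alpha>\<close>.  Conversely, let \<open>\<alpha> = \<alpha>\<gamma>\<alpha>\<close> and let \<open>y\<close> be in the image of
  \<open>\<alpha>\<close>.  Then \<open>y = (y\<gamma>)\<alpha> \<le> y\<gamma> \<le> y\<close>, because neither map can raise a point and so neither can
  undo a descent made by the other.  Hence \<open>y\<gamma> = y\<close> and \<open>y\<alpha> = y\<close>: the map \<open>\<alpha>\<close> fixes its image
  pointwise, which is idempotency.\<close>

lemma rcomp_apply: "x \<in> {1..n} \<Longrightarrow> rcomp n f g x = g (f x)"
  by (simp add: rcomp_def compose_def)

lemma ODCT_maps_to: "f \<in> ODCT n \<Longrightarrow> x \<in> {1..n} \<Longrightarrow> f x \<in> {1..n}"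
  unfolding ODCT_def by (blast dest: PiE_mem)

lemma ODCT_decreasing: "f \<in> ODCT n \<Longrightarrow> x \<in> {1..n} \<Longrightarrow> f x \<le> x"
  unfolding ODCT_def order_decreasing_on_def by blast

lemma ODCT_eqI:
  assumes "f \<in> ODCT n" "g \<in> ODCT n" "\<And>x. x \<in> {1..n} \<Longrightarrow> f x = g x"
  shows "f = g"
proof (rule PiE_ext)
  show "f \<in> {1..n} \<rightarrow>\<^sub>E {1..n}" "g \<in> {1..n} \<rightarrow>\<^sub>E {1..n}"
    using assms(1,2) by (simp_all add: ODCT_def)
qed (rule assms(3))

theorem corollary5:
  fixes n :: nat and \<alpha> :: "nat \<Rightarrow> nat"
  assumes "n \<ge> 1"
    and "\<alpha> \<in> ODCT n"
  shows "regular_elem (ODCT n) (rcomp n) \<alpha> \<longleftrightarrow> idempotent_elem (rcomp n) \<alpha>"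
proof
  assume "regular_elem (ODCT n) (rcomp n) \<alpha>"
  then obtain \<gamma> where \<gamma>: "\<gamma> \<in> ODCT n" and reg: "\<alpha> = rcomp n (rcomp n \<alpha> \<gamma>) \<alpha>"
    unfolding regular_elem_def by blast
  have "rcomp n \<alpha> \<alpha> = \<alpha>"
  proof (rule ODCT_eqI)
    fix x assume x: "x \<in> {1..n}"
    define y where "y = \<alpha> x"
    have y: "y \<in> {1..n}"
      using ODCT_maps_to[OF assms(2) x] by (simp add: y_def)
    have y_eq: "y = \<alpha> (\<gamma> y)"
      using fun_cong[OF reg, of x] x by (simp add: rcomp_apply y_def)
    have "y \<le> \<gamma> y"
      using ODCT_decreasing[OF assms(2) ODCT_maps_to[OF \<gamma> y]] y_eq by simp
    moreover have "\<gamma> y \<le> y"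
      using \<gamma> y by (rule ODCT_decreasing)
    ultimately have "\<alpha> y = y"
      using y_eq by simp
    then show "rcomp n \<alpha> \<alpha> x = \<alpha> x"
      using x by (simp add: rcomp_apply y_def)
  qed (use assms(2) in \<open>simp_all add: rcomp_closed\<close>)
  then show "idempotent_elem (rcomp n) \<alpha>"
    by (simp add: idempotent_elem_def)
next
  assume "idempotent_elem (rcomp n) \<alpha>"
  then have "\<alpha> = rcomp n (rcomp n \<alpha> \<alpha>) \<alpha>"
    by (simp add: idempotent_elem_def)
  then show "regular_elem (ODCT n) (rcomp n) \<alpha>"
    using assms(2) unfolding regular_elem_def by blast
qed

end
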